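(* Fix $\epsilon > 0$. For each integer $m \ge 2$ consider the following instance $I_m$ of Placement on a Line with locations $1,\dots,m$. The weight of the prefix $\{1,\dots,j\}$ is $\theta_j = 1/j^{1+\frac{1}{1+\epsilon}}$ for $j \in [m]$, and the objective of a placement $X$ is $W(X) = \sum_{j=1}^m \theta_j R(X(\{1,\dots,j\}))$. The choice model is MNL, and every product with preference weight $v$ has price $v^{-1/(1+\epsilon)}$. The products are: for each $j \in [m]$, $j$ distinct products each with preference weight $\epsilon/j$; and for each $j \in \{2,\dots,m\}$, a single product with preference weight $u_j = 1/(j \ln^{1+\epsilon} j)$. For $k \in [m]$, let $S^*_k$ be any assortment maximizing $R$ among assortments with at most $k$ products, let $X_k$ be an optimal placement among those using only products in $S^*_k$, and let $X$ be an optimal placement among all placements (using any products). Then there exist constants $c > 0$ and $m_0$ (depending only on $\epsilon$) such that for all $m \ge m_0$ and all $k \in [m]$, $$W(X) \;\ge\; c\,(\ln m)^{1-\epsilon}\, W(X_k).$$ That is, $W(X) = \Omega(\log^{1-\epsilon} m)\, W(X_k)$ for every $k \in [m]$.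
   Context: MNL choice model: each product $i$ has a preference weight $v_i > 0$, and for an assortment $S$, $\phi(i,S) = \frac{v_i}{1 + \sum_{l \in S} v_l}$ for $i \in S$; the expected revenue is $R(S) = \sum_{i \in S} r_i \phi(i,S)$ with $R(\emptyset)=0$. A placement on the line is a map $X$ from locations $\{1,\dots,m\}$ to products (a product may be placed at several locations), and $X(\{1,\dots,j\})$ denotes the set of products placed at locations $1,\dots,j$. (In Placement on a Line, $\theta_j$ is the weight of customers visiting exactly locations $1$ through $j$; as printed, the $\theta_j$ need not sum to one, which does not affect the ratio in the claim.) *)

theory Defs
  imports Complex_Main "HOL-Library.FuncSet"
begin

definition mnl_prob :: "('p \<Rightarrow> real) \<Rightarrow> 'p \<Rightarrow> 'p set \<Rightarrow> real" where
  "mnl_prob v i S = (if i \<in> S then v i / (1 + (\<Sum>l\<in>S. v l)) else 0)"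

definition mnl_revenue :: "('p \<Rightarrow> real) \<Rightarrow> ('p \<Rightarrow> real) \<Rightarrow> 'p set \<Rightarrow> real" where
  "mnl_revenue v r S = (\<Sum>i\<in>S. r i * mnl_prob v i S)"

definition line_placements :: "nat \<Rightarrow> 'p set \<Rightarrow> (nat \<Rightarrow> 'p) set" where
  "line_placements m P = {1..m} \<rightarrow>\<^sub>E P"

definition line_objective ::
  "nat \<Rightarrow> (nat \<Rightarrow> real) \<Rightarrow> ('p set \<Rightarrow> real) \<Rightarrow> (nat \<Rightarrow> 'p) \<Rightarrow> real" where
  "line_objective m \<theta> R X = (\<Sum>j=1..m. \<theta> j * R (X ` {1..j}))"

definition optimal_assortment :: "('p set \<Rightarrow> real) \<Rightarrow> 'p set \<Rightarrow> nat \<Rightarrow> 'p set \<Rightarrow> bool" where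
  "optimal_assortment R P k S \<longleftrightarrow> is_arg_max R (\<lambda>T. T \<subseteq> P \<and> card T \<le> k) S"

definition optimal_placement ::
  "((nat \<Rightarrow> 'p) \<Rightarrow> real) \<Rightarrow> nat \<Rightarrow> 'p set \<Rightarrow> (nat \<Rightarrow> 'p) \<Rightarrow> bool" where
  "optimal_placement W m P X \<longleftrightarrow> is_arg_max W (\<lambda>Y. Y \<in> line_placements m P) X"

text \<open>
  \<open>Block j i\<close> is the \<open>i\<close>-th of the \<open>j\<close> distinct products of weight \<open>\<epsilon> / j\<close>;
  \<open>Single j\<close> is the product of weight \<open>u\<^sub>j = 1 / (j ln\<^bsup>1+\<epsilon>\<^esup> j)\<close>. Separate
  constructors keep products distinct even when their weights coincide.
\<close>

datatype item = Block nat nat | Single nat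

definition items :: "nat \<Rightarrow> item set" where
  "items m = {Block j i | j i. j \<in> {1..m} \<and> i \<in> {1..j}} \<union> {Single j | j. j \<in> {2..m}}"

fun weight :: "real \<Rightarrow> item \<Rightarrow> real" where
  "weight \<epsilon> (Block j i) = \<epsilon> / real j"
| "weight \<epsilon> (Single j) = 1 / (real j * ln (real j) powr (1 + \<epsilon>))"

definition price :: "real \<Rightarrow> item \<Rightarrow> real" where
  "price \<epsilon> p = weight \<epsilon> p powr (- 1 / (1 + \<epsilon>))"

definition prefix_weight :: "real \<Rightarrow> nat \<Rightarrow> real" where
  "prefix_weight \<epsilon> j = 1 / real j powr (1 + 1 / (1 + \<epsilon>))"

definition revenue :: "real \<Rightarrow> item set \<Rightarrow> real" where
  "revenue \<epsilon> = mnl_revenue (weight \<epsilon>) (price \<epsilon>)"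

definition obj :: "real \<Rightarrow> nat \<Rightarrow> (nat \<Rightarrow> item) \<Rightarrow> real" where
  "obj \<epsilon> m = line_objective m (prefix_weight \<epsilon>) (revenue \<epsilon>)"

end

theory Submission
  imports Defs
begin

text \<open>
  Write \<open>a = 1 / (1 + \<epsilon>)\<close> and \<open>b = \<epsilon> / (1 + \<epsilon>)\<close>, so that \<open>R S = (\<Sum>v\<^sup>b) / (1 + \<Sum>v)\<close>.
  By strict concavity of \<open>t \<mapsto> t\<^sup>b\<close>, an optimal assortment of size at most \<open>k\<close> consists only of
  products of weight \<open>\<epsilon> / k\<close>. A prefix of length \<open>j\<close> then earns at most \<open>min j k (\<epsilon> / k)\<^sup>b\<close>, and
  summing against \<open>\<theta>\<^sub>j = j\<^bsup>-1-a\<^esup>\<close> gives a bound independent of \<open>k\<close> and \<open>m\<close>.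
  On the other hand, placing the single products in decreasing order of weight keeps the total
  weight bounded, since \<open>\<Sum>u\<^sub>j\<close> converges, and makes the prefix of length \<open>j\<close> earn at least a constant
  times \<open>j\<^sup>a / ln\<^sup>\<epsilon> j\<close>; summing gives a constant times \<open>ln\<^sup>1\<^sup>-\<^sup>\<epsilon> m\<close>.
\<close>

section \<open>Tangent bounds for powers\<close>

text \<open>Strict weighted AM-GM. With \<open>z\<close> the tangent value at \<open>t\<close>,
  apply \<open>ln x \<le> x - 1\<close> to \<open>t / z\<close> with weight \<open>b\<close> and to
  \<open>1 / z\<close> with weight \<open>1 - b\<close>; the right sides cancel by the choice of
  \<open>z\<close>, and \<open>t \<noteq> 1\<close> makes the second use strict.\<close>

lemma powr_less_tangent:
  fixes b t :: real
  assumes "0 < b" "b < 1" "0 < t" "t \<noteq> 1"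
  shows "t powr b < b * t + (1 - b)"
proof -
  define z where "z = b * t + (1 - b)"
  have z: "z > 0" unfolding z_def using assms by (simp add: add_pos_pos)
  have "z - 1 = b * (t - 1)" by (simp add: z_def algebra_simps)
  with assms have "z \<noteq> 1" by auto
  hence "1 / z \<noteq> 1" using z by simp
  hence "ln (1 / z) < 1 / z - 1"
    using ln_le_minus_one[of "1 / z"] ln_eq_minus_one[of "1 / z"] z by fastforce
  hence "(1 - b) * ln (1 / z) < (1 - b) * (1 / z - 1)" using assms by simp
  moreover have "b * ln (t / z) \<le> b * (t / z - 1)"
    using ln_le_minus_one[of "t / z"] z assms by simp
  moreover have "b * (t / z - 1) + (1 - b) * (1 / z - 1) = 0"
    using z by (simp add: field_simps) (simp add: z_def algebra_simps)
  ultimately have "b * ln (t / z) + (1 - b) * ln (1 / z) < 0" by linarith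
  hence "b * ln t < ln z" using z assms by (simp add: ln_div algebra_simps)
  hence "exp (b * ln t) < exp (ln z)" by (rule exp_less_mono)
  hence "t powr b < z" using z assms by (simp add: powr_def)
  thus ?thesis by (simp add: z_def)
qed

lemma powr_le_tangent:
  fixes b t :: real
  assumes "0 < b" "b < 1" "0 \<le> t"
  shows "t powr b \<le> b * t + (1 - b)"
  using powr_less_tangent[of b t] assms by (cases "t = 0 \<or> t = 1") auto

text \<open>The tangent bound at 1, rescaled by \<open>t = x / y\<close> to the tangent at
  \<open>y\<close>. Allowing \<open>x = 0\<close> lets telescoping sums start at zero.\<close>

lemma powr_diff_ge:
  fixes b x y :: real
  assumes "0 < b" "b < 1" "0 \<le> x" "0 < y"
  shows "y powr b - x powr b \<ge> b * (y - x) * y powr (b - 1)"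
proof -
  have "(x / y) powr b \<le> b * (x / y) + (1 - b)"
    using powr_le_tangent[of b "x / y"] assms by simp
  hence "y powr b * (x / y) powr b \<le> y powr b * (b * (x / y) + (1 - b))"
    by (simp add: mult_left_mono)
  moreover have "y powr b * (x / y) powr b = x powr b"
    using assms by (simp add: powr_divide)
  moreover have "y powr b * (b * (x / y) + (1 - b)) = y powr b - b * (y - x) * (y powr b / y)"
    using assms by (simp add: field_simps)
  moreover have "y powr b / y = y powr (b - 1)"
    using assms by (simp add: powr_diff)
  ultimately show ?thesis by simp
qed

text \<open>The convex counterpart for negative exponents: the graph lies above its tangent at
  \<open>y\<close>, by \<open>exp s \<ge> 1 + s\<close> and \<open>ln s \<le> s - 1\<close>.\<close>

lemma powr_minus_diff_ge:
  fixes p x y :: real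
  assumes "0 < p" "0 < x" "0 < y"
  shows "x powr (- p) - y powr (- p) \<ge> p * (y - x) * y powr (- 1 - p)"
proof -
  have "ln (x / y) \<le> x / y - 1" using assms by (intro ln_le_minus_one) simp
  hence "p * ln (x / y) \<le> p * (x / y - 1)" using assms by (intro mult_left_mono) auto
  moreover have "1 + (- p * ln (x / y)) \<le> exp (- p * ln (x / y))" by (rule exp_ge_add_one_self)
  ultimately have "exp (- p * ln (x / y)) \<ge> 1 - p * (x / y - 1)" by linarith
  hence "(x / y) powr (- p) \<ge> 1 - p * (x / y - 1)"
    using assms by (simp add: powr_def)
  hence "y powr (- p) * (x / y) powr (- p) \<ge> y powr (- p) * (1 - p * (x / y - 1))"
    by (simp add: mult_left_mono)
  moreover have "y powr (- p) * (x / y) powr (- p) = x powr (- p)"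
    using assms by (simp add: powr_divide)
  moreover have "y powr (- p) * (1 - p * (x / y - 1))
      = y powr (- p) + p * (y - x) * (y powr (- p) / y)"
    using assms by (simp add: field_simps)
  moreover have "y powr (- p) / y = y powr (- 1 - p)"
    using assms by (simp add: powr_diff powr_minus field_simps)
  ultimately show ?thesis by simp
qed

section \<open>Sums of powers\<close>

lemma sum_powr_le:
  fixes b :: real
  assumes "0 < b" "b < 1"
  shows "(\<Sum>j=1..k. real j powr (b - 1)) \<le> real k powr b / b"
proof (induction k)
  case (Suc k)
  have "real (Suc k) powr b - real k powr b \<ge> b * real (Suc k) powr (b - 1)"
    using powr_diff_ge[of b "real k" "real (Suc k)"] assms by simp
  hence "real (Suc k) powr (b - 1) \<le> (real (Suc k) powr b - real k powr b) / b"
    using assms by (simp add: field_simps)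
  with Suc show ?case by (simp add: diff_divide_distrib)
qed simp

text \<open>Integral comparison by telescoping. The subtracted term at \<open>m\<close> is what
  carries the induction; users drop it.\<close>

lemma sum_powr_tail_le:
  fixes a :: real
  assumes "0 < a" "1 \<le> k" "k \<le> m"
  shows "(\<Sum>j=Suc k..m. real j powr (- 1 - a)) \<le> (real k powr (- a) - real m powr (- a)) / a"
  using assms(3)
proof (induction m rule: dec_induct)
  case (step m)
  have "real m powr (- a) - real (Suc m) powr (- a) \<ge> a * real (Suc m) powr (- 1 - a)"
    using powr_minus_diff_ge[of a "real m" "real (Suc m)"] assms step by simp
  hence "real (Suc m) powr (- 1 - a) \<le> (real m powr (- a) - real (Suc m) powr (- a)) / a"
    using assms by (simp add: field_simps)
  with step show ?case by (simp add: diff_divide_distrib)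
qed simp

lemma ln_Suc_diff_ge: "n > 0 \<Longrightarrow> ln (real (Suc n)) - ln (real n) \<ge> 1 / real (Suc n)"
proof -
  assume n: "n > 0"
  have "ln (real n / real (Suc n)) \<le> real n / real (Suc n) - 1"
    using n by (intro ln_le_minus_one) simp
  also have "\<dots> = - (1 / real (Suc n))" by (simp add: field_simps)
  finally show ?thesis using n by (simp add: ln_div)
qed

lemma ln_Suc_diff_le: "n > 0 \<Longrightarrow> ln (real (Suc n)) - ln (real n) \<le> 1 / real n"
proof -
  assume n: "n > 0"
  have "ln (real (Suc n) / real n) \<le> real (Suc n) / real n - 1"
    using n by (intro ln_le_minus_one) simp
  also have "\<dots> = 1 / real n" using n by (simp add: field_simps)
  finally show ?thesis using n by (simp add: ln_div)
qed

text \<open>The summand is the derivative of \<open>- ln x powr (- e) / e\<close>, so an integral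
  comparison telescopes from the term at 2. Dropping the negative term leaves a bound independent of
  \<open>m\<close>.\<close>

lemma sum_inverse_ln_powr_le:
  fixes e :: real
  assumes "0 < e" "2 \<le> m"
  shows "(\<Sum>j=2..m. 1 / (real j * ln (real j) powr (1 + e)))
    \<le> 1 / (2 * ln 2 powr (1 + e)) + (ln 2 powr (- e) - ln (real m) powr (- e)) / e"
  using assms(2)
proof (induction m rule: dec_induct)
  case (step m)
  let ?x = "ln (real m)" and ?y = "ln (real (Suc m))"
  have pos: "?x > 0" "?y > 0" using step by auto
  \<comment> \<open>A discrete chain rule: first the increment of \<open>ln\<close>, then the
    convexity of the negative power at the two logarithms.\<close>
  have "e * (1 / real (Suc m)) * ?y powr (- 1 - e) \<le> e * (?y - ?x) * ?y powr (- 1 - e)"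
    using assms step by (intro mult_right_mono mult_left_mono ln_Suc_diff_ge) auto
  also have "\<dots> \<le> ?x powr (- e) - ?y powr (- e)"
    by (rule powr_minus_diff_ge[OF assms(1) pos])
  finally have *: "1 / real (Suc m) * ?y powr (- 1 - e) \<le> (?x powr (- e) - ?y powr (- e)) / e"
    using assms by (simp add: field_simps)
  have "?y powr (- 1 - e) = 1 / ?y powr (1 + e)"
    using powr_minus_divide[of ?y "1 + e"] by simp
  with * have "1 / (real (Suc m) * ?y powr (1 + e)) \<le> (?x powr (- e) - ?y powr (- e)) / e"
    by (simp add: mult.commute)
  with step show ?case by (simp add: diff_divide_distrib)
qed simp

lemma sum_inverse_ge_ln:
  assumes "1 \<le> m"
  shows "(\<Sum>j=2..m. 1 / real j) \<ge> ln (real m) / 2"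
  using assms
proof (induction m rule: dec_induct)
  case (step m)
  \<comment> \<open>The sum starts at 2, so the increment of \<open>ln\<close> is paid by the term
    of index \<open>Suc m\<close>; this shift costs the factor 2.\<close>
  have "1 / real m \<le> 2 / real (Suc m)" using step by (simp add: field_simps)
  with ln_Suc_diff_le[of m] step show ?case by simp
qed simp

section \<open>Revenue\<close>

lemma finite_items: "finite (items m)"
proof -
  have "items m \<subseteq> (\<lambda>(j, i). Block j i) ` ({1..m} \<times> {1..m}) \<union> Single ` {2..m}"
    unfolding items_def by fastforce
  thus ?thesis by (rule finite_subset) auto
qed

lemma weight_pos: "\<epsilon> > 0 \<Longrightarrow> p \<in> items m \<Longrightarrow> weight \<epsilon> p > 0"
  by (auto simp: items_def)

lemma revenue_eq:
  assumes "\<epsilon> > 0" "S \<subseteq> items m"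
  shows "revenue \<epsilon> S = (\<Sum>p\<in>S. weight \<epsilon> p powr (\<epsilon> / (1 + \<epsilon>))) / (1 + (\<Sum>p\<in>S. weight \<epsilon> p))"
proof -
  have "price \<epsilon> p * weight \<epsilon> p = weight \<epsilon> p powr (\<epsilon> / (1 + \<epsilon>))" if "p \<in> S" for p
  proof -
    have "weight \<epsilon> p > 0" using that assms weight_pos by blast
    hence "price \<epsilon> p * weight \<epsilon> p = weight \<epsilon> p powr (- 1 / (1 + \<epsilon>) + 1)"
      unfolding price_def powr_add by simp
    also have "- 1 / (1 + \<epsilon>) + 1 = \<epsilon> / (1 + \<epsilon>)" using assms by (simp add: field_simps)
    finally show ?thesis .
  qed
  thus ?thesis
    unfolding revenue_def mnl_revenue_def mnl_prob_def
    by (simp add: sum_divide_distrib)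
qed

lemma revenue_equal_weights:
  assumes "\<epsilon> > 0" "S \<subseteq> items m" "\<And>p. p \<in> S \<Longrightarrow> weight \<epsilon> p = w"
  shows "revenue \<epsilon> S = real (card S) * w powr (\<epsilon> / (1 + \<epsilon>)) / (1 + real (card S) * w)"
  by (simp add: revenue_eq[OF assms(1,2)] assms(3))

text \<open>A full block has total weight exactly \<epsilon>, whence the denominator. This value is
  the benchmark for all assortments of size at most \<open>k\<close>.\<close>

lemma revenue_block:
  assumes "\<epsilon> > 0" "k \<in> {1..m}"
  shows "revenue \<epsilon> (Block k ` {1..k}) = real k * (\<epsilon> / real k) powr (\<epsilon> / (1 + \<epsilon>)) / (1 + \<epsilon>)"
proof -
  have "card (Block k ` {1..k}) = k" by (subst card_image) (auto simp: inj_on_def)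
  moreover have "Block k ` {1..k} \<subseteq> items m" using assms by (auto simp: items_def)
  moreover have "weight \<epsilon> p = \<epsilon> / real k" if "p \<in> Block k ` {1..k}" for p
    using that by auto
  ultimately show ?thesis
    using revenue_equal_weights[of \<epsilon> "Block k ` {1..k}" m "\<epsilon> / real k"] assms by simp
qed

text \<open>Bound each power by its tangent at \<open>w = \<epsilon> / k\<close>. For this tangent
  point the bounds sum to at most a constant times \<open>1 + V\<close>, which cancels the MNL
  denominator. The product \<open>p\<close> off the tangent point gives strictness.\<close>

lemma revenue_less_block:
  assumes "\<epsilon> > 0" "1 \<le> k" "S \<subseteq> items m" "card S \<le> k" "p \<in> S" "weight \<epsilon> p \<noteq> \<epsilon> / real k"
  shows "revenue \<epsilon> S < real k * (\<epsilon> / real k) powr (\<epsilon> / (1 + \<epsilon>)) / (1 + \<epsilon>)"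
proof -
  define b where "b = \<epsilon> / (1 + \<epsilon>)"
  define w where "w = \<epsilon> / real k"
  define V where "V = (\<Sum>q\<in>S. weight \<epsilon> q)"
  have b: "0 < b" "b < 1" "1 - b = 1 / (1 + \<epsilon>)" using assms by (auto simp: b_def field_simps)
  have w: "w > 0" using assms by (simp add: w_def)
  have fin: "finite S" using assms finite_items finite_subset by blast
  have pos: "weight \<epsilon> q > 0" if "q \<in> S" for q using that assms weight_pos by blast
  have V: "V \<ge> 0" unfolding V_def using pos by (intro sum_nonneg) (auto simp: less_imp_le)
  have scale: "weight \<epsilon> q powr b = w powr b * (weight \<epsilon> q / w) powr b" if "q \<in> S" for q
    using pos[OF that] w by (simp add: powr_divide)
  have "(\<Sum>q\<in>S. weight \<epsilon> q powr b) < (\<Sum>q\<in>S. w powr b * (b * (weight \<epsilon> q / w) + (1 - b)))"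
  proof (rule sum_strict_mono_ex1[OF fin])
    show "\<forall>q\<in>S. weight \<epsilon> q powr b \<le> w powr b * (b * (weight \<epsilon> q / w) + (1 - b))"
    proof
      fix q assume q: "q \<in> S"
      show "weight \<epsilon> q powr b \<le> w powr b * (b * (weight \<epsilon> q / w) + (1 - b))"
        unfolding scale[OF q] using pos[OF q] w b
        by (intro mult_left_mono powr_le_tangent) auto
    qed
    have "weight \<epsilon> p powr b < w powr b * (b * (weight \<epsilon> p / w) + (1 - b))"
      unfolding scale[OF assms(5)] using pos[OF assms(5)] w b assms(6)
      by (intro mult_strict_left_mono powr_less_tangent) (auto simp: w_def[symmetric])
    thus "\<exists>q\<in>S. weight \<epsilon> q powr b < w powr b * (b * (weight \<epsilon> q / w) + (1 - b))"
      using assms(5) by blast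
  qed
  also have "\<dots> = w powr b * (b * (V / w) + real (card S) * (1 - b))"
    by (simp add: V_def sum.distrib flip: sum_distrib_left sum_divide_distrib)
  also have "\<dots> \<le> w powr b * (b * (V / w) + real k * (1 - b))"
    using assms b by (intro mult_left_mono add_left_mono mult_right_mono) auto
  \<comment> \<open>Here \<open>b / w = k / (1 + \<epsilon>)\<close> and
    \<open>1 - b = 1 / (1 + \<epsilon>)\<close>, so \<open>V\<close> and 1 get the same
    coefficient.\<close>
  also have "b * (V / w) + real k * (1 - b) = real k * (1 + V) / (1 + \<epsilon>)"
  proof -
    have "b * (V / w) = real k * V / (1 + \<epsilon>)"
      using assms(1,2) by (simp add: b_def w_def)
    thus ?thesis unfolding b(3) by (simp add: distrib_left add_divide_distrib)
  qed
  finally have "(\<Sum>q\<in>S. weight \<epsilon> q powr b) < real k * w powr b / (1 + \<epsilon>) * (1 + V)"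
    by (simp add: algebra_simps)
  hence "(\<Sum>q\<in>S. weight \<epsilon> q powr b) / (1 + V) < real k * w powr b / (1 + \<epsilon>)"
    using V by (simp add: pos_divide_less_eq)
  thus ?thesis
    unfolding revenue_eq[OF assms(1,3)] b_def w_def V_def .
qed

text \<open>The block of index \<open>k\<close> is a feasible competitor that strictly beats any
  assortment containing another weight. The claim concerns weights rather than constructors, since a
  \<open>Single\<close> could share the weight of the block.\<close>

lemma optimal_assortment_weight:
  assumes "\<epsilon> > 0" "k \<in> {1..m}" "optimal_assortment (revenue \<epsilon>) (items m) k S" "p \<in> S"
  shows "weight \<epsilon> p = \<epsilon> / real k"
proof (rule ccontr)
  assume "weight \<epsilon> p \<noteq> \<epsilon> / real k"
  moreover have S: "S \<subseteq> items m" "card S \<le> k"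
    and opt: "\<And>T. T \<subseteq> items m \<Longrightarrow> card T \<le> k \<Longrightarrow> \<not> revenue \<epsilon> S < revenue \<epsilon> T"
    using assms(3) by (auto simp: optimal_assortment_def is_arg_max_def)
  ultimately have "revenue \<epsilon> S < revenue \<epsilon> (Block k ` {1..k})"
    unfolding revenue_block[OF assms(1,2)] using revenue_less_block[of \<epsilon> k S m p] assms by simp
  moreover have "Block k ` {1..k} \<subseteq> items m" using assms by (auto simp: items_def)
  moreover have "card (Block k ` {1..k}) \<le> k"
    using card_image_le[of "{1..k}" "Block k"] by simp
  ultimately show False using opt by blast
qed

section \<open>Placements\<close>

text \<open>Up to location \<open>k\<close> the prefix revenue grows at most linearly, afterwards it
  is capped. Against the prefix weights both ranges contribute order \<open>k powr b\<close>, which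
  \<open>w powr b\<close> cancels.\<close>

lemma obj_equal_weights_le:
  assumes "\<epsilon> > 0" "k \<in> {1..m}" "S \<subseteq> items m" "card S \<le> k"
    "\<And>p. p \<in> S \<Longrightarrow> weight \<epsilon> p = \<epsilon> / real k" "X \<in> line_placements m S"
  shows "obj \<epsilon> m X \<le> \<epsilon> powr (\<epsilon> / (1 + \<epsilon>)) * ((1 + \<epsilon>) / \<epsilon> + (1 + \<epsilon>))"
proof -
  define b where "b = \<epsilon> / (1 + \<epsilon>)"
  define a where "a = 1 / (1 + \<epsilon>)"
  define w where "w = \<epsilon> / real k"
  have ab: "0 < a" "0 < b" "b < 1" "a = 1 - b"
    using assms by (auto simp: a_def b_def field_simps)
  have k: "1 \<le> k" "k \<le> m" using assms by auto
  have w: "w > 0" using assms by (simp add: w_def)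
  have fin: "finite S" using assms finite_items finite_subset by blast
  have rev: "revenue \<epsilon> (X ` {1..j}) \<le> real (min j k) * w powr b" if j: "j \<in> {1..m}" for j
  proof -
    let ?n = "real (card (X ` {1..j}))"
    have sub: "X ` {1..j} \<subseteq> S"
      using assms(6) j by (auto simp: line_placements_def PiE_def Pi_def)
    \<comment> \<open>Repeated products can make a prefix contain fewer than \<open>j\<close> items,
      so only an upper bound is available.\<close>
    have "card (X ` {1..j}) \<le> min j k"
      using card_image_le[of "{1..j}" X] card_mono[OF fin sub] assms(4) by simp
    hence n: "?n \<le> real (min j k)" by (rule of_nat_mono)
    have "revenue \<epsilon> (X ` {1..j}) = ?n * w powr b / (1 + ?n * w)"
      unfolding b_def using sub assms by (intro revenue_equal_weights) (auto simp: w_def)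
    also have "\<dots> \<le> ?n * w powr b / 1"
      using w by (intro divide_left_mono) (auto simp: add_pos_nonneg)
    also have "\<dots> \<le> real (min j k) * w powr b"
      using n by (simp add: mult_right_mono)
    finally show ?thesis .
  qed
  have theta: "prefix_weight \<epsilon> j = real j powr (- 1 - a)" for j
    using powr_minus_divide[of "real j" "1 + a"]
    by (simp add: prefix_weight_def a_def[symmetric])
  have "obj \<epsilon> m X \<le> (\<Sum>j=1..m. real j powr (- 1 - a) * (real (min j k) * w powr b))"
    unfolding obj_def line_objective_def theta
    by (intro sum_mono mult_left_mono rev) auto
  also have "\<dots> = w powr b * (\<Sum>j=1..m. real j powr (- 1 - a) * real (min j k))"
    by (simp add: sum_distrib_left mult_ac)
  also have "(\<Sum>j=1..m. real j powr (- 1 - a) * real (min j k))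
      = (\<Sum>j=1..k. real j powr (- 1 - a) * real (min j k))
        + (\<Sum>j=Suc k..m. real j powr (- 1 - a) * real (min j k))"
    using sum.ub_add_nat[of 1 k "\<lambda>j. real j powr (- 1 - a) * real (min j k)" "m - k"] k by simp
  also have "(\<Sum>j=1..k. real j powr (- 1 - a) * real (min j k)) = (\<Sum>j=1..k. real j powr (b - 1))"
  proof (rule sum.cong)
    fix j assume j: "j \<in> {1..k}"
    hence "real j powr (- 1 - a) * real j = real j powr (- 1 - a + 1)"
      by (simp only: powr_add) simp
    thus "real j powr (- 1 - a) * real (min j k) = real j powr (b - 1)"
      using j ab by simp
  qed simp
  also have "(\<Sum>j=Suc k..m. real j powr (- 1 - a) * real (min j k))
      = real k * (\<Sum>j=Suc k..m. real j powr (- 1 - a))"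
    by (auto simp: sum_distrib_left mult_ac intro!: sum.cong)
  also have "w powr b * ((\<Sum>j=1..k. real j powr (b - 1)) + real k * (\<Sum>j=Suc k..m. real j powr (- 1 - a)))
      \<le> w powr b * (real k powr b / b + real k * (real k powr (- a) / a))"
  proof (intro mult_left_mono add_mono)
    show "(\<Sum>j=1..k. real j powr (b - 1)) \<le> real k powr b / b"
      using sum_powr_le ab by blast
    have "(\<Sum>j=Suc k..m. real j powr (- 1 - a)) \<le> (real k powr (- a) - real m powr (- a)) / a"
      using sum_powr_tail_le ab k by blast
    also have "\<dots> \<le> real k powr (- a) / a" using ab by (simp add: divide_right_mono)
    finally show "(\<Sum>j=Suc k..m. real j powr (- 1 - a)) \<le> real k powr (- a) / a" .
  qed auto
  also have "real k * (real k powr (- a) / a) = real k powr b / a"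
  proof -
    have "b = 1 + - a" using ab by simp
    thus ?thesis using k by (simp only: powr_add) simp
  qed
  also have "w powr b * (real k powr b / b + real k powr b / a) = \<epsilon> powr b * (1 / b + 1 / a)"
    using k assms by (simp add: w_def powr_divide field_simps)
  also have "1 / b + 1 / a = (1 + \<epsilon>) / \<epsilon> + (1 + \<epsilon>)" by (simp add: a_def b_def)
  finally show ?thesis by (simp add: b_def)
qed

text \<open>The weights decrease, so each of the \<open>j - 1 \<ge> j / 2\<close> numerator terms is
  at least \<open>u j powr b\<close>, while \<open>U\<close> caps the denominator. As
  \<open>(1 + \<epsilon>) * b = \<epsilon>\<close>, the logarithm gets exponent
  \<open>- \<epsilon>\<close>.\<close>

lemma revenue_singles_ge:
  assumes "\<epsilon> > 0" "2 \<le> j" "j \<le> m"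
    and U: "(\<Sum>i=2..j. 1 / (real i * ln (real i) powr (1 + \<epsilon>))) \<le> U"
  shows "revenue \<epsilon> (Single ` {2..j})
    \<ge> real j powr (1 / (1 + \<epsilon>)) * ln (real j) powr (- \<epsilon>) / (2 * (1 + U))"
proof -
  define b where "b = \<epsilon> / (1 + \<epsilon>)"
  define u where "u = (\<lambda>i::nat. 1 / (real i * ln (real i) powr (1 + \<epsilon>)))"
  have b: "0 < b" "1 / (1 + \<epsilon>) = 1 - b" "(1 + \<epsilon>) * b = \<epsilon>"
    using assms by (auto simp: b_def field_simps)
  have upos: "u i > 0" if "2 \<le> i" for i using that by (simp add: u_def)
  have umono: "u j \<le> u i" if "2 \<le> i" "i \<le> j" for i
    unfolding u_def using that assms
    by (intro divide_left_mono mult_mono powr_mono2) auto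
  have uj: "u j powr b = real j powr (- b) * ln (real j) powr (- \<epsilon>)"
  proof -
    have "u j powr b = 1 / (real j powr b * ln (real j) powr ((1 + \<epsilon>) * b))"
      using assms by (simp add: u_def powr_divide powr_mult powr_powr)
    thus ?thesis unfolding b(3) by (simp add: powr_minus field_simps)
  qed
  have sub: "Single ` {2..j} \<subseteq> items m" using assms by (auto simp: items_def)
  have inj: "inj_on Single {2..j}" by (auto simp: inj_on_def)
  have rev: "revenue \<epsilon> (Single ` {2..j}) = (\<Sum>i=2..j. u i powr b) / (1 + (\<Sum>i=2..j. u i))"
    unfolding revenue_eq[OF assms(1) sub] by (simp add: sum.reindex[OF inj] b_def u_def)
  have U0: "(\<Sum>i=2..j. u i) \<ge> 0" using upos by (intro sum_nonneg) (auto simp: less_imp_le)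
  have "real j / 2 * u j powr b \<le> real (j - 1) * u j powr b"
    using assms by (intro mult_right_mono) (auto simp: of_nat_diff)
  also have "\<dots> = (\<Sum>i=2..j. u j powr b)" using assms by simp
  also have "\<dots> \<le> (\<Sum>i=2..j. u i powr b)"
    using assms b upos[of j] by (intro sum_mono powr_mono2 umono) (auto simp: less_imp_le)
  finally have num: "real j / 2 * u j powr b \<le> (\<Sum>i=2..j. u i powr b)" .
  have "real j * real j powr (- b) = real j powr (1 / (1 + \<epsilon>))"
    unfolding b(2) using assms by (simp add: powr_diff powr_minus field_simps)
  hence "real j / 2 * u j powr b / (1 + U)
      = real j powr (1 / (1 + \<epsilon>)) * ln (real j) powr (- \<epsilon>) / (2 * (1 + U))"
    unfolding uj by (simp flip: mult.assoc)
  moreover have "real j / 2 * u j powr b / (1 + U)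
      \<le> (\<Sum>i=2..j. u i powr b) / (1 + (\<Sum>i=2..j. u i))"
    using num U U0 by (intro frac_le sum_nonneg) (auto simp: u_def)
  ultimately show ?thesis unfolding rev by argo
qed

text \<open>The prefix weight turns the power of \<open>j\<close> in the revenue into
  \<open>1 / j\<close>. Replacing \<open>ln j\<close> by \<open>ln m\<close> in the negative power
  leaves a harmonic sum, which supplies one more factor \<open>ln m\<close>.\<close>

lemma exists_placement_obj_ge:
  assumes "\<epsilon> > 0" "2 \<le> m"
    and U: "\<And>j. 2 \<le> j \<Longrightarrow> (\<Sum>i=2..j. 1 / (real i * ln (real i) powr (1 + \<epsilon>))) \<le> U"
  shows "\<exists>Y \<in> line_placements m (items m). obj \<epsilon> m Y \<ge> ln (real m) powr (1 - \<epsilon>) / (4 * (1 + U))"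
proof
  define Y where "Y = restrict (\<lambda>j. Single (max 2 j)) {1..m}"
  show "Y \<in> line_placements m (items m)"
    using assms by (auto simp: Y_def line_placements_def items_def max_def)
  have "0 \<le> (\<Sum>i=2..2::nat. 1 / (real i * ln (real i) powr (1 + \<epsilon>)))" by simp
  with U[of 2] have U0: "U \<ge> 0" by linarith
  have img: "Y ` {1..j} = Single ` {2..j}" if "2 \<le> j" "j \<le> m" for j
  proof -
    have "Y ` {1..j} = (\<lambda>j. Single (max 2 j)) ` {1..j}"
      using that by (auto simp: Y_def intro!: image_cong)
    also have "\<dots> = Single ` (max 2 ` {1..j})" by (simp add: image_image)
    also have "max 2 ` {1..j} = {2..j}"
    proof (intro equalityI subsetI)
      fix i assume "i \<in> {2..j}"
      thus "i \<in> max 2 ` {1..j}" by (intro image_eqI[of _ _ i]) auto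
    qed (use that in auto)
    finally show ?thesis .
  qed
  \<comment> \<open>The first location contributes no growth; nonnegativity suffices to discard
    it.\<close>
  have one: "prefix_weight \<epsilon> 1 * revenue \<epsilon> (Y ` {1..1}) \<ge> 0"
    using assms by (simp add: Y_def prefix_weight_def revenue_def mnl_revenue_def mnl_prob_def price_def)
  have summand: "prefix_weight \<epsilon> j * revenue \<epsilon> (Y ` {1..j})
      \<ge> ln (real m) powr (- \<epsilon>) / (2 * (1 + U)) * (1 / real j)" if "j \<in> {2..m}" for j
  proof -
    have j: "2 \<le> j" "j \<le> m" using that by auto
    have "ln (real m) powr (- \<epsilon>) \<le> ln (real j) powr (- \<epsilon>)"
      using j assms by (intro powr_mono2') auto
    hence "ln (real m) powr (- \<epsilon>) / (2 * (1 + U)) * (1 / real j)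
        \<le> ln (real j) powr (- \<epsilon>) / (2 * (1 + U)) * (1 / real j)"
      using U0 by (intro mult_right_mono divide_right_mono) auto
    also have "\<dots> = prefix_weight \<epsilon> j
        * (real j powr (1 / (1 + \<epsilon>)) * ln (real j) powr (- \<epsilon>) / (2 * (1 + U)))"
      using j by (simp add: prefix_weight_def powr_add)
    also have "\<dots> \<le> prefix_weight \<epsilon> j * revenue \<epsilon> (Y ` {1..j})"
      unfolding img[OF j]
      by (intro mult_left_mono revenue_singles_ge[OF assms(1) j U[OF j(1)]])
        (simp add: prefix_weight_def)
    finally show ?thesis .
  qed
  have "ln (real m) powr (1 - \<epsilon>) / (4 * (1 + U))
      = ln (real m) powr (- \<epsilon>) / (2 * (1 + U)) * (ln (real m) / 2)"
    using assms U0 by (simp add: powr_diff powr_minus field_simps)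
  also have "\<dots> \<le> ln (real m) powr (- \<epsilon>) / (2 * (1 + U)) * (\<Sum>j=2..m. 1 / real j)"
    using assms U0 by (intro mult_left_mono sum_inverse_ge_ln) auto
  also have "\<dots> \<le> (\<Sum>j=2..m. prefix_weight \<epsilon> j * revenue \<epsilon> (Y ` {1..j}))"
    unfolding sum_distrib_left by (intro sum_mono summand)
  also have "\<dots> \<le> (\<Sum>j=1..m. prefix_weight \<epsilon> j * revenue \<epsilon> (Y ` {1..j}))"
  proof -
    have "{1..m} = insert 1 {2..m}" using assms by auto
    thus ?thesis using one by simp
  qed
  finally show "obj \<epsilon> m Y \<ge> ln (real m) powr (1 - \<epsilon>) / (4 * (1 + U))"
    by (simp add: obj_def line_objective_def)
qed

theorem theorem4:
  fixes \<epsilon> :: real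
  assumes "\<epsilon> > 0"
  shows "\<exists>c>0. \<exists>m\<^sub>0. \<forall>m\<ge>m\<^sub>0. 2 \<le> m \<longrightarrow>
    (\<forall>k\<in>{1..m}. \<forall>S X\<^sub>k X.
      optimal_assortment (revenue \<epsilon>) (items m) k S \<longrightarrow>
      optimal_placement (obj \<epsilon> m) m S X\<^sub>k \<longrightarrow>
      optimal_placement (obj \<epsilon> m) m (items m) X \<longrightarrow>
      obj \<epsilon> m X \<ge> c * ln (real m) powr (1 - \<epsilon>) * obj \<epsilon> m X\<^sub>k)"
proof -
  define U where "U = 1 / (2 * ln 2 powr (1 + \<epsilon>)) + ln 2 powr (- \<epsilon>) / \<epsilon>"
  define C where "C = \<epsilon> powr (\<epsilon> / (1 + \<epsilon>)) * ((1 + \<epsilon>) / \<epsilon> + (1 + \<epsilon>))"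
  have U0: "U \<ge> 0" using assms by (simp add: U_def)
  have C: "C > 0" unfolding C_def using assms by (intro mult_pos_pos add_pos_pos) auto
  have U: "(\<Sum>i=2..j. 1 / (real i * ln (real i) powr (1 + \<epsilon>))) \<le> U" if "2 \<le> j" for j
  proof -
    have "(ln 2 powr (- \<epsilon>) - ln (real j) powr (- \<epsilon>)) / \<epsilon> \<le> ln 2 powr (- \<epsilon>) / \<epsilon>"
      using assms by (simp add: divide_right_mono)
    with sum_inverse_ln_powr_le[OF assms that] show ?thesis by (simp add: U_def)
  qed
  \<comment> \<open>Chosen so that \<open>c * C = 1 / (4 * (1 + U))\<close>, the constant achieved
    by the explicit placement.\<close>
  define c where "c = 1 / (4 * (1 + U) * C)"
  have c: "c > 0" using U0 C by (simp add: c_def)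
  have "obj \<epsilon> m X \<ge> c * ln (real m) powr (1 - \<epsilon>) * obj \<epsilon> m X\<^sub>k"
    if m: "2 \<le> m" and k: "k \<in> {1..m}"
      and S: "optimal_assortment (revenue \<epsilon>) (items m) k S"
      and Xk: "optimal_placement (obj \<epsilon> m) m S X\<^sub>k"
      and X: "optimal_placement (obj \<epsilon> m) m (items m) X" for m k S X\<^sub>k X
  proof -
    have "obj \<epsilon> m X\<^sub>k \<le> C"
      unfolding C_def
    proof (rule obj_equal_weights_le[OF assms k])
      show "S \<subseteq> items m" "card S \<le> k"
        using S by (auto simp: optimal_assortment_def is_arg_max_def)
      show "X\<^sub>k \<in> line_placements m S"
        using Xk by (auto simp: optimal_placement_def is_arg_max_def)
    qed (rule optimal_assortment_weight[OF assms k S])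
    hence "c * ln (real m) powr (1 - \<epsilon>) * obj \<epsilon> m X\<^sub>k \<le> c * ln (real m) powr (1 - \<epsilon>) * C"
      using c by (intro mult_left_mono) auto
    also have "\<dots> = ln (real m) powr (1 - \<epsilon>) / (4 * (1 + U))"
      using C U0 by (simp add: c_def)
    also obtain Y where "Y \<in> line_placements m (items m)"
      and "ln (real m) powr (1 - \<epsilon>) / (4 * (1 + U)) \<le> obj \<epsilon> m Y"
      using exists_placement_obj_ge[OF assms m U] by blast
    note this(2)
    also have "obj \<epsilon> m Y \<le> obj \<epsilon> m X"
      using X \<open>Y \<in> _\<close> by (auto simp: optimal_placement_def is_arg_max_def not_less)
    finally show ?thesis .
  qed
  with c show ?thesis by blast
qed

end
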